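(* Let $X$ be a Banach space and let $Y$ be a strict ideal of $X$. If $Y^*$ has $w^*$-$BHP$, then $X^*$ has $w^*$-$BHP$.
   Context: All Banach spaces are real and nontrivial ($\neq \{0\}$). For a Banach space $Z$, $B_Z$ is its closed unit ball. Ideals and strict ideals: for a closed subspace $Y \subseteq X$ let $Y^\perp = \{x^* \in X^* : x^*(y) = 0 \ \forall y \in Y\}$. $Y$ is an ideal in $X$ if $Y^\perp$ is the kernel of a norm one linear projection in $X^*$. $Y$ is a strict ideal in $X$ if there is a linear projection $P : X^* \to X^*$ with $\|P\| = 1$, $\ker(P) = Y^\perp$, and such that $B_{P(X^* )}$ is $w^*$-dense in $B_{X^*}$ (equivalently, $B_{P(X^* )}$ is a norming set for $X$, i.e. $\|x\| = \sup\{|x^*(x)| : x^* \in B_{P(X^* )}\}$ for all $x \in X$). A dual space $X^*$ has $w^*$-$BHP$ if for every $\varepsilon > 0$ there is a nonempty relatively $w^*$-open subset of $B_{X^*}$ (for $\sigma(X^*,X)$) with (norm) diameter less than $\varepsilon$. For $Y^*$ the $w^*$-topology is $\sigma(Y^*,Y)$. *)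

theory Defs
  imports "HOL-Analysis.Analysis"
begin

text \<open>The dual of a Banach space is \<^typ>\<open>'a \<Rightarrow>\<^sub>L real\<close>; for scalar-valued operators
  the strong operator topology is the topology of pointwise convergence, that is, the
  weak-star topology.\<close>

abbreviation weak_star_topology :: "('a::real_normed_vector \<Rightarrow>\<^sub>L real) topology"
  where "weak_star_topology \<equiv> strong_operator_topology"

definition annihilator :: "'a::real_normed_vector set \<Rightarrow> ('a \<Rightarrow>\<^sub>L real) set"
  where "annihilator Y = {f. \<forall>y\<in>Y. blinfun_apply f y = 0}"

definition strict_ideal :: "'a::banach set \<Rightarrow> bool"
  where "strict_ideal Y \<longleftrightarrow> subspace Y \<and> closed Y \<and>
    (\<exists>P :: ('a \<Rightarrow>\<^sub>L real) \<Rightarrow>\<^sub>L ('a \<Rightarrow>\<^sub>L real).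
        P o\<^sub>L P = P \<and> norm P = 1 \<and>
        {f. blinfun_apply P f = 0} = annihilator Y \<and>
        cball 0 1 \<subseteq> weak_star_topology closure_of (range (blinfun_apply P) \<inter> cball 0 1))"

text \<open>A closed subspace is a set and not a type, so the elements of its dual are functions that
  are linear and bounded on the subspace, with the fixed value \<^term>\<open>undefined\<close> outside it. This
  is the convention of \<^const>\<open>product_topology\<close>, whose subspace topology is then the
  weak-star topology.\<close>

definition dual_on :: "'a::real_normed_vector set \<Rightarrow> ('a \<Rightarrow> real) set"
  where "dual_on Y = {f \<in> extensional Y.
    (\<forall>x\<in>Y. \<forall>y\<in>Y. f (x + y) = f x + f y) \<and>
    (\<forall>c. \<forall>x\<in>Y. f (c *\<^sub>R x) = c * f x) \<and>
    (\<exists>K. \<forall>x\<in>Y. \<bar>f x\<bar> \<le> K * norm x)}"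

text \<open>Only the values on the subspace enter the norm, so it also applies to pointwise
  differences, which need not be extensional.\<close>

definition dual_norm_on :: "'a::real_normed_vector set \<Rightarrow> ('a \<Rightarrow> real) \<Rightarrow> real"
  where "dual_norm_on Y f = (SUP y \<in> Y \<inter> cball 0 1. \<bar>f y\<bar>)"

definition dual_dist_on :: "'a::real_normed_vector set \<Rightarrow> ('a \<Rightarrow> real) \<Rightarrow> ('a \<Rightarrow> real) \<Rightarrow> real"
  where "dual_dist_on Y f g = dual_norm_on Y (\<lambda>y. f y - g y)"

definition dual_ball_on :: "'a::real_normed_vector set \<Rightarrow> ('a \<Rightarrow> real) set"
  where "dual_ball_on Y = {f \<in> dual_on Y. dual_norm_on Y f \<le> 1}"

definition weak_star_topology_on :: "'a::real_normed_vector set \<Rightarrow> ('a \<Rightarrow> real) topology"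
  where "weak_star_topology_on Y = subtopology (product_topology (\<lambda>_. euclidean) Y) (dual_on Y)"

text \<open>The common shape of the property for both representations of a dual space, with topology
  \<open>T\<close>, closed unit ball \<open>B\<close> and distance \<open>d\<close>. The supremum is the diameter of \<open>U\<close>.\<close>

definition small_relatively_open_sets ::
    "'f topology \<Rightarrow> 'f set \<Rightarrow> ('f \<Rightarrow> 'f \<Rightarrow> real) \<Rightarrow> bool"
  where "small_relatively_open_sets T B d \<longleftrightarrow>
    (\<forall>\<epsilon>>0. \<exists>U. openin (subtopology T B) U \<and> U \<noteq> {} \<and> (SUP (f, g) \<in> U \<times> U. d f g) < \<epsilon>)"

definition dual_has_weak_star_BHP :: "'a::real_normed_vector itself \<Rightarrow> bool"
  where "dual_has_weak_star_BHP TYPE('a) \<longleftrightarrow>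
    small_relatively_open_sets (weak_star_topology :: ('a \<Rightarrow>\<^sub>L real) topology) (cball 0 1) dist"

definition dual_has_weak_star_BHP_on :: "'a::real_normed_vector set \<Rightarrow> bool"
  where "dual_has_weak_star_BHP_on Y \<longleftrightarrow>
    small_relatively_open_sets (weak_star_topology_on Y) (dual_ball_on Y) (dual_dist_on Y)"

text \<open>The two representations agree when the subspace is the whole space.\<close>

lemma dual_on_UNIV: "dual_on (UNIV :: 'a::real_normed_vector set) = range blinfun_apply"
proof (intro set_eqI iffI)
  fix f :: "'a \<Rightarrow> real"
  assume "f \<in> dual_on UNIV"
  then obtain K where "\<And>x y. f (x + y) = f x + f y" "\<And>c x. f (c *\<^sub>R x) = c * f x"
    "\<And>x. \<bar>f x\<bar> \<le> K * norm x"
    by (auto simp: dual_on_def)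
  then have "bounded_linear f"
    by (intro bounded_linear_intro[where K = K]) (auto simp: mult.commute)
  then show "f \<in> range blinfun_apply"
    by (metis bounded_linear_Blinfun_apply rangeI)
next
  fix f :: "'a \<Rightarrow> real"
  assume "f \<in> range blinfun_apply"
  then obtain g where f: "f = blinfun_apply g" by auto
  have "\<bar>blinfun_apply g x\<bar> \<le> norm g * norm x" for x
    using norm_blinfun[of g x] by simp
  then show "f \<in> dual_on UNIV"
    unfolding dual_on_def f by (auto simp: blinfun.add_right blinfun.scaleR_right)
qed

lemma dual_norm_on_UNIV: "dual_norm_on UNIV (blinfun_apply g) = norm g"
proof (rule antisym)
  have le: "\<bar>blinfun_apply g y\<bar> \<le> norm g" if "norm y \<le> 1" for y
    using norm_blinfun[of g y] mult_left_mono[OF that norm_ge_zero[of g]] by simp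
  show "dual_norm_on UNIV (blinfun_apply g) \<le> norm g"
    unfolding dual_norm_on_def by (rule cSUP_least) (auto intro: le exI[of _ 0])
  have bdd: "bdd_above ((\<lambda>y. \<bar>blinfun_apply g y\<bar>) ` (UNIV \<inter> cball 0 1))"
    by (intro bdd_aboveI[where M = "norm g"]) (auto intro: le)
  have up: "\<bar>blinfun_apply g y\<bar> \<le> dual_norm_on UNIV (blinfun_apply g)" if "norm y \<le> 1" for y
    unfolding dual_norm_on_def using that by (intro cSUP_upper bdd) auto
  have nn: "0 \<le> dual_norm_on UNIV (blinfun_apply g)"
    using up[of 0] by (simp add: blinfun.zero_right)
  show "norm g \<le> dual_norm_on UNIV (blinfun_apply g)"
  proof (rule norm_blinfun_bound[OF nn])
    fix x
    show "norm (blinfun_apply g x) \<le> dual_norm_on UNIV (blinfun_apply g) * norm x"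
    proof (cases "x = 0")
      case False
      have "\<bar>blinfun_apply g (inverse (norm x) *\<^sub>R x)\<bar> \<le> dual_norm_on UNIV (blinfun_apply g)"
        by (rule up) (use False in simp)
      with False show ?thesis
        by (simp add: blinfun.scaleR_right abs_mult field_simps)
    qed (simp add: blinfun.zero_right)
  qed
qed

lemma dual_dist_on_UNIV:
  "dual_dist_on UNIV (blinfun_apply f) (blinfun_apply g) = dist f g"
  using dual_norm_on_UNIV[of "f - g"]
  by (simp add: dual_dist_on_def dist_norm blinfun.diff_left[abs_def])

lemma dual_ball_on_UNIV: "dual_ball_on UNIV = blinfun_apply ` cball 0 1"
  by (auto simp: dual_ball_on_def dual_on_UNIV dual_norm_on_UNIV)

lemma dual_has_weak_star_BHP_on_UNIV:
  "dual_has_weak_star_BHP_on (UNIV :: 'a::real_normed_vector set) \<longleftrightarrow>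
   dual_has_weak_star_BHP TYPE('a)"
proof -
  let ?B = "cball 0 1 :: ('a \<Rightarrow>\<^sub>L real) set"
  have X: "openin (subtopology weak_star_topology ?B) U \<longleftrightarrow>
      (\<exists>W. open W \<and> U = blinfun_apply -` W \<inter> ?B)" for U
    unfolding openin_subtopology strong_operator_topology_def openin_pullback_topology by auto
  have Y: "openin (subtopology (weak_star_topology_on UNIV) (dual_ball_on UNIV)) V \<longleftrightarrow>
      (\<exists>W. open W \<and> V = blinfun_apply ` (blinfun_apply -` W \<inter> ?B))" for V
  proof -
    have "blinfun_apply ` (blinfun_apply -` W \<inter> ?B)
        = W \<inter> (range blinfun_apply \<inter> blinfun_apply ` ?B)" for W
      by auto
    then show ?thesis
      unfolding weak_star_topology_on_def subtopology_subtopology dual_on_UNIV dual_ball_on_UNIV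
        openin_subtopology by (simp add: euclidean_product_topology)
  qed
  have D: "(SUP (f, g) \<in> (blinfun_apply ` U) \<times> (blinfun_apply ` U). dual_dist_on UNIV f g)
      = (SUP (f, g) \<in> U \<times> U. dist f g)" for U :: "('a \<Rightarrow>\<^sub>L real) set"
  proof -
    have "(blinfun_apply ` U) \<times> (blinfun_apply ` U)
        = (\<lambda>(f, g). (blinfun_apply f, blinfun_apply g)) ` (U \<times> U)"
      by auto
    then show ?thesis
      by (simp add: image_image case_prod_unfold dual_dist_on_UNIV)
  qed
  have ex: "(\<exists>V. (\<exists>W. open W \<and> V = h W) \<and> Q V) \<longleftrightarrow> (\<exists>W. open W \<and> Q (h W))"
    for h :: "('a \<Rightarrow> real) set \<Rightarrow> 'c" and Q by auto
  show ?thesis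
    unfolding dual_has_weak_star_BHP_on_def dual_has_weak_star_BHP_def
      small_relatively_open_sets_def X Y ex D by simp
qed

end

theory Submission
  imports Defs
begin

text \<open>Let \<open>P\<close> be the projection of the strict ideal \<open>Y\<close>. The kernel of \<open>P\<close> is the annihilator of
  \<open>Y\<close>, so \<open>P h\<close> depends only on the restriction of \<open>h\<close> to \<open>Y\<close>. By the Hahn--Banach theorem that
  restriction is also the restriction of a functional of norm \<open>dual_norm_on Y h\<close>; as \<open>P\<close> is a
  contraction, restriction to \<open>Y\<close> is isometric on the range of \<open>P\<close>
  (\<open>norm_le_dual_norm_on_of_range\<close>).

  Now let \<open>U\<close> be a nonempty relatively weak-star open set of diameter \<open>d < \<epsilon>\<close> in the unit ball
  of the dual of \<open>Y\<close>, and let \<open>V\<close> be the set of functionals in the unit ball of the whole dual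
  whose restriction lies in \<open>U\<close>. Restriction is weak-star continuous, so \<open>V\<close> is relatively open,
  and it is nonempty by Hahn--Banach once more. Any two functionals in \<open>V\<close> are weak-star limits of
  functionals in \<open>V\<close> that lie in the range of \<open>P\<close>, because the unit ball of the range is
  weak-star dense. Those are at distance at most \<open>d\<close>, by the isometry, and the dual norm is
  weak-star lower semicontinuous; hence \<open>V\<close> has diameter at most \<open>d\<close>
  (\<open>dist_le_of_dense\<close>).

  The Hahn--Banach theorem itself is derived from the fact that a minimal sublinear functional is
  linear.\<close>

section \<open>Sublinear functionals\<close>

text \<open>Applying the second condition also to \<open>inverse c\<close> turns it into an equality, and at the
  origin it then gives the value zero.\<close>

definition sublinear :: "('a::real_vector \<Rightarrow> real) \<Rightarrow> bool"
  where "sublinear p \<longleftrightarrow> (\<forall>x y. p (x + y) \<le> p x + p y) \<and> (\<forall>c>0. \<forall>x. p (c *\<^sub>R x) \<le> c * p x)"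

lemma sublinear_add: "sublinear p \<Longrightarrow> p (x + y) \<le> p x + p y"
  by (simp add: sublinear_def)

lemma sublinear_scaleR_pos:
  assumes "sublinear p" "c > 0"
  shows "p (c *\<^sub>R x) = c * p x"
proof (rule antisym)
  show "p (c *\<^sub>R x) \<le> c * p x"
    using assms by (simp add: sublinear_def)
  have "p (inverse c *\<^sub>R (c *\<^sub>R x)) \<le> inverse c * p (c *\<^sub>R x)"
    using assms unfolding sublinear_def by (metis positive_imp_inverse_positive)
  then show "c * p x \<le> p (c *\<^sub>R x)"
    using assms(2) by (simp add: field_simps)
qed

lemma sublinear_zero: "sublinear p \<Longrightarrow> p 0 = 0"
  using sublinear_scaleR_pos[of p 2 0] by simp

lemma sublinear_scaleR: "sublinear p \<Longrightarrow> c \<ge> 0 \<Longrightarrow> p (c *\<^sub>R x) = c * p x"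
  by (cases "c = 0") (simp_all add: sublinear_zero sublinear_scaleR_pos)

lemma sublinear_ge_minus: "sublinear p \<Longrightarrow> - p (- x) \<le> p x"
  using sublinear_add[of p x "- x"] by (simp add: sublinear_zero)

text \<open>All the sublinear functionals below arise as infima of families that are stable enough
  under sums and positive multiples of the argument; the members need not be sublinear.\<close>

lemma sublinear_INF:
  fixes F :: "'i \<Rightarrow> 'a::real_vector \<Rightarrow> real"
  assumes ne: "I \<noteq> {}"
    and bdd: "\<And>x. bdd_below ((\<lambda>i. F i x) ` I)"
    and add: "\<And>i j x y. i \<in> I \<Longrightarrow> j \<in> I \<Longrightarrow> \<exists>k\<in>I. F k (x + y) \<le> F i x + F j y"
    and scale: "\<And>i c x. i \<in> I \<Longrightarrow> c > 0 \<Longrightarrow> \<exists>k\<in>I. F k (c *\<^sub>R x) \<le> c * F i x"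
  shows "sublinear (\<lambda>x. INF i\<in>I. F i x)"
  unfolding sublinear_def
proof (intro conjI allI impI)
  fix x y
  let ?s = "INF i\<in>I. F i (x + y)"
  have "?s \<le> F i x + F j y" if ij: "i \<in> I" "j \<in> I" for i j
  proof -
    obtain k where k: "k \<in> I" "F k (x + y) \<le> F i x + F j y"
      using add[OF ij] by blast
    have "?s \<le> F k (x + y)"
      by (rule cINF_lower[OF bdd k(1)])
    with k(2) show ?thesis by simp
  qed
  then have "?s - F j y \<le> (INF i\<in>I. F i x)" if "j \<in> I" for j
    using that by (intro cINF_greatest[OF ne]) (simp add: diff_le_eq)
  then have "?s - (INF i\<in>I. F i x) \<le> (INF j\<in>I. F j y)"
    by (intro cINF_greatest[OF ne]) (simp add: algebra_simps)
  then show "?s \<le> (INF i\<in>I. F i x) + (INF i\<in>I. F i y)"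
    by simp
next
  fix c :: real and x
  assume c: "c > 0"
  let ?s = "INF i\<in>I. F i (c *\<^sub>R x)"
  have "?s / c \<le> F i x" if i: "i \<in> I" for i
  proof -
    obtain k where k: "k \<in> I" "F k (c *\<^sub>R x) \<le> c * F i x"
      using scale[OF i c] by blast
    have "?s \<le> F k (c *\<^sub>R x)"
      by (rule cINF_lower[OF bdd k(1)])
    with k(2) c show ?thesis by (simp add: field_simps)
  qed
  then have "?s / c \<le> (INF i\<in>I. F i x)"
    by (rule cINF_greatest[OF ne])
  then show "?s \<le> c * (INF i\<in>I. F i x)"
    using c by (simp add: field_simps)
qed

text \<open>Zorn's lemma applies because the pointwise infimum of a chain of sublinear functionals below
  \<open>p\<close> is finite: each member is at least \<open>- p (- x)\<close> at \<open>x\<close>.\<close>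

lemma minimal_sublinear_exists:
  assumes p: "sublinear p"
  obtains m where "sublinear m" "\<And>x. m x \<le> p x"
    "\<And>g. sublinear g \<Longrightarrow> (\<And>x. g x \<le> m x) \<Longrightarrow> g = m"
proof -
  define A where "A = {g. sublinear g \<and> g \<le> p}"
  have "\<exists>m\<in>A. \<forall>g\<in>A. m \<ge> g \<longrightarrow> g = m"
  proof (rule predicate_Zorn)
    show "partial_order_on A (relation_of (\<ge>) A)"
      by (rule partial_order_on_relation_ofI) auto
    fix C
    assume C: "C \<in> Chains (relation_of (\<ge>) A)"
    then have CA: "C \<subseteq> A"
      by (rule Chains_relation_of)
    have total: "g \<le> h \<or> h \<le> g" if "g \<in> C" "h \<in> C" for g h
      using C that unfolding Chains_def relation_of_def by blast
    show "\<exists>u\<in>A. \<forall>g\<in>C. g \<ge> u"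
    proof (cases "C = {}")
      case True
      then show ?thesis using p by (auto simp: A_def)
    next
      case False
      define u where "u = (\<lambda>x. INF g\<in>C. g x)"
      have lower: "- p (- x) \<le> g x" if "g \<in> C" for g x
      proof -
        have "sublinear g" "g (- x) \<le> p (- x)"
          using that CA by (auto simp: A_def le_fun_def)
        then show ?thesis using sublinear_ge_minus[of g x] by linarith
      qed
      have bdd: "bdd_below ((\<lambda>g. g x) ` C)" for x
        using lower by (intro bdd_belowI[where m = "- p (- x)"]) auto
      have "sublinear u"
        unfolding u_def
      proof (rule sublinear_INF[OF False bdd])
        fix g h x y
        assume gh: "g \<in> C" "h \<in> C"
        then have sub: "sublinear g" "sublinear h"
          using CA by (auto simp: A_def)
        \<comment> \<open>The smaller of the two functionals serves both summands.\<close>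
        from total[OF gh] show "\<exists>k\<in>C. k (x + y) \<le> g x + h y"
        proof
          assume "g \<le> h"
          then have "g (x + y) \<le> g x + h y"
            using sublinear_add[OF sub(1), of x y] le_funD[of g h y] by linarith
          with gh show ?thesis by blast
        next
          assume "h \<le> g"
          then have "h (x + y) \<le> g x + h y"
            using sublinear_add[OF sub(2), of x y] le_funD[of h g x] by linarith
          with gh show ?thesis by blast
        qed
      next
        fix g and c :: real and x
        assume "g \<in> C" "c > 0"
        then show "\<exists>k\<in>C. k (c *\<^sub>R x) \<le> c * g x"
          using CA by (intro bexI[of _ g]) (auto simp: A_def sublinear_scaleR_pos)
      qed
      moreover have below: "u \<le> g" if "g \<in> C" for g
        unfolding u_def le_fun_def using that by (auto intro: cINF_lower[OF bdd])
      moreover have "u \<le> p"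
      proof -
        obtain g where "g \<in> C" using False by blast
        with below[of g] CA show ?thesis by (auto simp: A_def)
      qed
      ultimately show ?thesis
        by (intro bexI[of _ u]) (auto simp: A_def)
    qed
  qed
  then obtain m where m: "m \<in> A" and min: "\<And>g. g \<in> A \<Longrightarrow> g \<le> m \<Longrightarrow> g = m"
    by blast
  show thesis
  proof (rule that[of m])
    show "sublinear m" "m x \<le> p x" for x
      using m by (auto simp: A_def le_fun_def)
    show "g = m" if "sublinear g" "\<And>x. g x \<le> m x" for g
    proof (rule min)
      have "g \<le> m" using that(2) by (simp add: le_fun_def)
      then show "g \<in> A" "g \<le> m"
        using that(1) m by (auto simp: A_def)
    qed
  qed
qed

text \<open>A sublinear \<open>m\<close> can be lowered in the direction of \<open>y\<close> to the infimum over \<open>t \<ge> 0\<close> of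
  \<open>m (x + t y) - t m y\<close>, whose value at \<open>- y\<close> is at most \<open>- m y\<close> (take \<open>t = 1\<close>). If \<open>m\<close> is
  minimal this changes nothing, so \<open>m\<close> is odd, and an odd sublinear functional is linear.\<close>

lemma minimal_sublinear_linear:
  assumes m: "sublinear m"
    and min: "\<And>g. sublinear g \<Longrightarrow> (\<And>x. g x \<le> m x) \<Longrightarrow> g = m"
  shows "linear m"
proof -
  have odd: "m (- y) = - m y" for y
  proof -
    define F where "F = (\<lambda>t x. m (x + t *\<^sub>R y) - t * m y)"
    define g where "g = (\<lambda>x. INF t\<in>{0..}. F t x)"
    have lower: "- m (- x) \<le> F t x" if "t \<ge> 0" for t x
      using sublinear_add[OF m, of "x + t *\<^sub>R y" "- x"] sublinear_scaleR[OF m that, of y]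
      by (simp add: F_def)
    have bdd: "bdd_below ((\<lambda>t. F t x) ` {0..})" for x
      using lower by (intro bdd_belowI[where m = "- m (- x)"]) auto
    have "sublinear g"
      unfolding g_def
    proof (rule sublinear_INF[OF _ bdd])
      show "\<exists>r\<in>{0..}. F r (x + z) \<le> F s x + F t z" if "s \<in> {0..}" "t \<in> {0..}" for s t x z
      proof (rule bexI[of _ "s + t"])
        show "F (s + t) (x + z) \<le> F s x + F t z"
          using sublinear_add[OF m, of "x + s *\<^sub>R y" "z + t *\<^sub>R y"]
          by (simp add: F_def algebra_simps)
      qed (use that in auto)
      show "\<exists>r\<in>{0..}. F r (c *\<^sub>R x) \<le> c * F t x" if "t \<in> {0..}" "c > 0" for t c x
      proof (rule bexI[of _ "c * t"])
        show "F (c * t) (c *\<^sub>R x) \<le> c * F t x"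
          using sublinear_scaleR_pos[OF m that(2), of "x + t *\<^sub>R y"]
          by (simp add: F_def algebra_simps)
      qed (use that in auto)
    qed auto
    moreover have "g x \<le> m x" for x
      using cINF_lower[OF bdd, of 0 x] by (simp add: g_def F_def)
    ultimately have "g = m"
      by (rule min)
    moreover have "g (- y) \<le> - m y"
      using cINF_lower[OF bdd, of 1 "- y"] by (simp add: g_def F_def sublinear_zero[OF m])
    ultimately show ?thesis
      using sublinear_ge_minus[OF m, of y] by simp
  qed
  show ?thesis
  proof (rule linearI)
    show "m (x + y) = m x + m y" for x y
    proof (rule antisym)
      have "- m (x + y) = m (- x + - y)"
        using odd[of "x + y"] by simp
      also have "\<dots> \<le> - m x - m y"
        using sublinear_add[OF m, of "- x" "- y"] by (simp add: odd)
      finally show "m x + m y \<le> m (x + y)"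
        by simp
    qed (rule sublinear_add[OF m])
    show "m (c *\<^sub>R x) = c *\<^sub>R m x" for c x
    proof (cases "c \<ge> 0")
      case False
      then show ?thesis
        using sublinear_scaleR[OF m, of "- c" x] odd[of "c *\<^sub>R x"] by simp
    qed (simp add: sublinear_scaleR[OF m])
  qed
qed

section \<open>Norm-preserving extension of functionals\<close>

text \<open>A functional below the sublinear \<open>q x = (INF y\<in>Y. f y + K * norm (x - y))\<close> is bounded by
  \<open>K\<close> (take \<open>y = 0\<close>) and is at most \<open>f\<close> on \<open>Y\<close> (take \<open>y = x\<close>); by linearity it then equals \<open>f\<close>
  there. A minimal sublinear functional below \<open>q\<close> is linear, so it is such an extension.\<close>

lemma hahn_banach_extension:
  fixes Y :: "'a::real_normed_vector set"
  assumes Y: "subspace Y"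
    and add: "\<And>x y. x \<in> Y \<Longrightarrow> y \<in> Y \<Longrightarrow> f (x + y) = f x + f y"
    and scale: "\<And>c x. x \<in> Y \<Longrightarrow> f (c *\<^sub>R x) = c * f x"
    and K: "K \<ge> 0" "\<And>y. y \<in> Y \<Longrightarrow> \<bar>f y\<bar> \<le> K * norm y"
  obtains k :: "'a \<Rightarrow>\<^sub>L real"
  where "\<And>y. y \<in> Y \<Longrightarrow> blinfun_apply k y = f y" "norm k \<le> K"
proof -
  define F where "F = (\<lambda>y x. f y + K * norm (x - y))"
  define q where "q = (\<lambda>x. INF y\<in>Y. F y x)"
  have lower: "- (K * norm x) \<le> F y x" if "y \<in> Y" for x y
  proof -
    have "K * norm y \<le> K * (norm x + norm (x - y))"
      using K(1) norm_triangle_sub[of y x] by (intro mult_left_mono) (simp_all add: norm_minus_commute)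
    with K(2)[OF that] show ?thesis
      by (simp add: F_def algebra_simps)
  qed
  have bdd: "bdd_below ((\<lambda>y. F y x) ` Y)" for x
    using lower by (intro bdd_belowI[where m = "- (K * norm x)"]) auto
  have q_le: "q x \<le> F y x" if "y \<in> Y" for x y
    unfolding q_def by (rule cINF_lower[OF bdd that])
  have f0: "f 0 = 0"
    using scale[OF subspace_0[OF Y], of 0] by simp
  have "sublinear q"
    unfolding q_def
  proof (rule sublinear_INF[OF _ bdd])
    show "Y \<noteq> {}"
      using subspace_0[OF Y] by blast
    show "\<exists>w\<in>Y. F w (x + x') \<le> F y x + F z x'" if yz: "y \<in> Y" "z \<in> Y" for y z x x'
    proof (rule bexI[of _ "y + z"])
      have "K * norm ((x - y) + (x' - z)) \<le> K * (norm (x - y) + norm (x' - z))"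
        by (intro mult_left_mono norm_triangle_ineq K(1))
      then show "F (y + z) (x + x') \<le> F y x + F z x'"
        by (simp add: F_def add[OF yz] algebra_simps)
    qed (rule subspace_add[OF Y yz])
    show "\<exists>w\<in>Y. F w (c *\<^sub>R x) \<le> c * F y x" if y: "y \<in> Y" and c: "c > 0" for y c x
    proof (rule bexI[of _ "c *\<^sub>R y"])
      have "norm (c *\<^sub>R x - c *\<^sub>R y) = c * norm (x - y)"
        using c by (simp flip: scaleR_diff_right)
      then show "F (c *\<^sub>R y) (c *\<^sub>R x) \<le> c * F y x"
        by (simp add: F_def scale[OF y] algebra_simps)
    qed (rule subspace_scale[OF Y y])
  qed
  then obtain m where m: "sublinear m" "\<And>x. m x \<le> q x"
    "\<And>g. sublinear g \<Longrightarrow> (\<And>x. g x \<le> m x) \<Longrightarrow> g = m"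
    by (rule minimal_sublinear_exists) blast
  then have lin: "linear m"
    by (intro minimal_sublinear_linear) auto
  have up: "m x \<le> K * norm x" for x
    using m(2)[of x] q_le[OF subspace_0[OF Y], of x] by (simp add: F_def f0)
  have bound: "\<bar>m x\<bar> \<le> K * norm x" for x
    using up[of x] up[of "- x"] by (simp add: linear_neg[OF lin])
  have "bounded_linear m"
    using lin bound by (intro bounded_linear.intro bounded_linear_axioms.intro)
      (auto simp: mult.commute intro!: exI[of _ K])
  then have app: "blinfun_apply (Blinfun m) = m"
    by (rule bounded_linear_Blinfun_apply)
  show thesis
  proof
    have on_Y: "m y \<le> f y" if "y \<in> Y" for y
      using m(2)[of y] q_le[OF that, of y] by (simp add: F_def)
    show "blinfun_apply (Blinfun m) y = f y" if y: "y \<in> Y" for y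
      using on_Y[OF y] on_Y[OF subspace_neg[OF Y y]] scale[OF y, of "- 1"]
      by (simp add: app linear_neg[OF lin])
    show "norm (Blinfun m) \<le> K"
      using bound by (intro norm_blinfun_bound K(1)) (simp add: app)
  qed
qed

section \<open>Functionals on a subspace\<close>

lemma dual_norm_on_cong:
  "(\<And>y. y \<in> Y \<Longrightarrow> f y = g y) \<Longrightarrow> dual_norm_on Y f = dual_norm_on Y g"
  unfolding dual_norm_on_def by (intro SUP_cong) auto

lemma dual_on_bdd_above:
  assumes "f \<in> dual_on Y"
  shows "bdd_above ((\<lambda>y. \<bar>f y\<bar>) ` (Y \<inter> cball 0 1))"
proof -
  obtain K where K: "\<And>y. y \<in> Y \<Longrightarrow> \<bar>f y\<bar> \<le> K * norm y"
    using assms unfolding dual_on_def by blast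
  show ?thesis
  proof (rule bdd_aboveI2)
    fix y
    assume y: "y \<in> Y \<inter> cball 0 1"
    then have "K * norm y \<le> \<bar>K\<bar> * 1"
      by (intro mult_mono) auto
    with K[of y] y show "\<bar>f y\<bar> \<le> \<bar>K\<bar>" by auto
  qed
qed

lemma dual_norm_on_nonneg:
  assumes "subspace Y" "f \<in> dual_on Y"
  shows "0 \<le> dual_norm_on Y f"
proof -
  have "\<bar>f 0\<bar> \<le> dual_norm_on Y f"
    unfolding dual_norm_on_def
    by (rule cSUP_upper[OF _ dual_on_bdd_above[OF assms(2)]]) (simp add: subspace_0[OF assms(1)])
  then show ?thesis by linarith
qed

lemma abs_le_dual_norm_on:
  assumes Y: "subspace Y" and f: "f \<in> dual_on Y" and y: "y \<in> Y"
  shows "\<bar>f y\<bar> \<le> dual_norm_on Y f * norm y"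
proof (cases "y = 0")
  case True
  have "f (0 *\<^sub>R y) = 0 * f y"
    using f y unfolding dual_on_def by blast
  with True show ?thesis by simp
next
  case False
  have s: "f (inverse (norm y) *\<^sub>R y) = inverse (norm y) * f y"
    using f y by (simp add: dual_on_def)
  have "\<bar>f (inverse (norm y) *\<^sub>R y)\<bar> \<le> dual_norm_on Y f"
    unfolding dual_norm_on_def
    by (rule cSUP_upper[OF _ dual_on_bdd_above[OF f]])
      (use False subspace_scale[OF Y y] in simp)
  then have "\<bar>f y\<bar> / norm y \<le> dual_norm_on Y f"
    unfolding s by (simp add: abs_mult divide_inverse mult.commute)
  with False show ?thesis
    by (simp add: pos_divide_le_eq)
qed

lemma restrict_blinfun_in_dual_on:
  assumes "subspace Y"
  shows "restrict (blinfun_apply h) Y \<in> dual_on Y"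
proof -
  have "\<bar>blinfun_apply h y\<bar> \<le> norm h * norm y" for y
    using norm_blinfun[of h y] by simp
  then show ?thesis
    using subspace_add[OF assms] subspace_scale[OF assms]
    by (auto simp: dual_on_def blinfun.add_right blinfun.scaleR_right)
qed

lemma dual_norm_on_blinfun_le:
  assumes "subspace Y"
  shows "dual_norm_on Y (blinfun_apply h) \<le> norm h"
  unfolding dual_norm_on_def
proof (rule cSUP_least)
  show "Y \<inter> cball 0 1 \<noteq> {}"
    using subspace_0[OF assms] by auto
  fix y
  assume "y \<in> Y \<inter> cball 0 1"
  then show "\<bar>blinfun_apply h y\<bar> \<le> norm h"
    using norm_blinfun[of h y] mult_left_mono[of "norm y" 1 "norm h"] by simp
qed

lemma restrict_in_dual_ball_on:
  assumes "subspace Y" "norm h \<le> 1"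
  shows "restrict (blinfun_apply h) Y \<in> dual_ball_on Y"
  using dual_norm_on_blinfun_le[OF assms(1), of h] assms(2)
    restrict_blinfun_in_dual_on[OF assms(1), of h]
    dual_norm_on_cong[of Y "restrict (blinfun_apply h) Y" "blinfun_apply h"]
  by (simp add: dual_ball_on_def)

lemma dual_on_extension:
  fixes Y :: "'a::real_normed_vector set"
  assumes Y: "subspace Y" and f: "f \<in> dual_on Y"
  obtains k :: "'a \<Rightarrow>\<^sub>L real"
  where "restrict (blinfun_apply k) Y = f" "norm k \<le> dual_norm_on Y f"
proof -
  obtain k :: "'a \<Rightarrow>\<^sub>L real" where k: "\<And>y. y \<in> Y \<Longrightarrow> blinfun_apply k y = f y"
    "norm k \<le> dual_norm_on Y f"
  proof (rule hahn_banach_extension[OF Y])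
    show "f (x + y) = f x + f y" if "x \<in> Y" "y \<in> Y" for x y
      using f that by (simp add: dual_on_def)
    show "f (c *\<^sub>R x) = c * f x" if "x \<in> Y" for c x
      using f that by (simp add: dual_on_def)
  qed (use dual_norm_on_nonneg[OF Y f] abs_le_dual_norm_on[OF Y f] in auto)
  have "f \<in> extensional Y"
    using f by (simp add: dual_on_def)
  then have "restrict (blinfun_apply k) Y = f"
    using k(1) by (intro extensionalityI[OF restrict_extensional]) auto
  with k(2) that show thesis by blast
qed

lemma dual_dist_on_restrict:
  "dual_dist_on Y (restrict (blinfun_apply g) Y) (restrict (blinfun_apply h) Y)
    = dual_norm_on Y (blinfun_apply (g - h))"
  unfolding dual_dist_on_def by (rule dual_norm_on_cong) (simp add: blinfun.diff_left)

text \<open>This makes the supremum defining the diameter of a set in the ball a genuine one.\<close>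

lemma dual_dist_on_ball_le:
  assumes Y: "subspace Y" and f: "f \<in> dual_ball_on Y" and g: "g \<in> dual_ball_on Y"
  shows "dual_dist_on Y f g \<le> 2"
proof -
  obtain k where k: "restrict (blinfun_apply k) Y = f" "norm k \<le> 1"
    using dual_on_extension[OF Y] f unfolding dual_ball_on_def
    by (metis (no_types, lifting) mem_Collect_eq order_trans)
  obtain l where l: "restrict (blinfun_apply l) Y = g" "norm l \<le> 1"
    using dual_on_extension[OF Y] g unfolding dual_ball_on_def
    by (metis (no_types, lifting) mem_Collect_eq order_trans)
  have "dual_dist_on Y f g = dual_norm_on Y (blinfun_apply (k - l))"
    using dual_dist_on_restrict[of Y k l] by (simp add: k(1) l(1))
  also have "\<dots> \<le> norm (k - l)"
    by (rule dual_norm_on_blinfun_le[OF Y])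
  also have "\<dots> \<le> 2"
    using norm_triangle_ineq4[of k l] k(2) l(2) by simp
  finally show ?thesis .
qed

lemma continuous_map_restrict_weak_star:
  "continuous_map weak_star_topology (product_topology (\<lambda>_. euclidean) Y)
    (\<lambda>h. restrict (blinfun_apply h) Y)"
  unfolding continuous_map_componentwise
  using strong_operator_topology_continuous_evaluation by auto

section \<open>Strict ideals\<close>

text \<open>Replace \<open>h\<close> by an extension \<open>k\<close> of its restriction with the norm of the restriction. The
  difference \<open>h - k\<close> lies in the annihilator, so \<open>P k = P h = h\<close> and the norm of \<open>h\<close> is at most
  that of \<open>k\<close>.\<close>

lemma norm_le_dual_norm_on_of_range:
  fixes P :: "('a::real_normed_vector \<Rightarrow>\<^sub>L real) \<Rightarrow>\<^sub>L ('a \<Rightarrow>\<^sub>L real)"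
  assumes Y: "subspace Y"
    and P: "norm P \<le> 1" "annihilator Y \<subseteq> {f. blinfun_apply P f = 0}"
    and h: "blinfun_apply P h = h"
  shows "norm h \<le> dual_norm_on Y (blinfun_apply h)"
proof -
  obtain k where k: "restrict (blinfun_apply k) Y = restrict (blinfun_apply h) Y"
    "norm k \<le> dual_norm_on Y (restrict (blinfun_apply h) Y)"
    using dual_on_extension[OF Y restrict_blinfun_in_dual_on[OF Y]] by blast
  have "blinfun_apply k y = blinfun_apply h y" if "y \<in> Y" for y
    using fun_cong[OF k(1), of y] that by simp
  then have "h - k \<in> annihilator Y"
    by (simp add: annihilator_def blinfun.diff_left)
  then have "blinfun_apply P k = h"
    using P(2) h by (auto simp: blinfun.diff_right)
  then have "norm h \<le> norm P * norm k"
    using norm_blinfun[of P k] by simp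
  also have "\<dots> \<le> norm k"
    using mult_right_mono[OF P(1) norm_ge_zero[of k]] by simp
  also have "\<dots> \<le> dual_norm_on Y (blinfun_apply h)"
    using k(2) dual_norm_on_cong[of Y "restrict (blinfun_apply h) Y" "blinfun_apply h"] by simp
  finally show ?thesis .
qed

text \<open>Within a weak-star open set, a diameter bound passes from \<open>D\<close> to its weak-star closure,
  since the norm is a supremum of weak-star continuous functions: for each \<open>x\<close> the members of
  \<open>W \<inter> D\<close> may be chosen to approximate \<open>f\<close> and \<open>g\<close> at \<open>x\<close>.\<close>

lemma dist_le_of_dense:
  fixes f g :: "'a::real_normed_vector \<Rightarrow>\<^sub>L real"
  assumes W: "openin weak_star_topology W"
    and f: "f \<in> W" "f \<in> weak_star_topology closure_of D"
    and g: "g \<in> W" "g \<in> weak_star_topology closure_of D"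
    and d: "d \<ge> 0" "\<And>h k. h \<in> W \<inter> D \<Longrightarrow> k \<in> W \<inter> D \<Longrightarrow> dist h k \<le> d"
  shows "dist f g \<le> d"
proof -
  have approx: "\<exists>h\<in>W \<inter> D. \<bar>blinfun_apply h x - blinfun_apply e x\<bar> < \<delta>"
    if e: "e \<in> W" "e \<in> weak_star_topology closure_of D" and \<delta>: "\<delta> > 0" for e x \<delta>
  proof -
    define N where
      "N = {h \<in> topspace weak_star_topology. blinfun_apply h x \<in> ball (blinfun_apply e x) \<delta>}"
    have "openin weak_star_topology (W \<inter> N)"
      unfolding N_def by (intro openin_Int W openin_continuous_map_preimage
            [OF strong_operator_topology_continuous_evaluation]) simp
    moreover have "e \<in> W \<inter> N"
      using e \<delta> by (simp add: N_def strong_operator_topology_topspace)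
    ultimately obtain h where "h \<in> D" "h \<in> W \<inter> N"
      using e(2) unfolding in_closure_of by blast
    then show ?thesis
      by (intro bexI[of _ h]) (auto simp: N_def dist_real_def abs_minus_commute)
  qed
  have "norm (f - g) \<le> d"
  proof (rule norm_blinfun_bound[OF d(1)])
    fix x
    show "norm (blinfun_apply (f - g) x) \<le> d * norm x"
    proof (rule field_le_epsilon)
      fix \<epsilon> :: real
      assume "\<epsilon> > 0"
      then have \<delta>: "\<epsilon> / 2 > 0" by simp
      obtain h where h: "h \<in> W \<inter> D" "\<bar>blinfun_apply h x - blinfun_apply f x\<bar> < \<epsilon> / 2"
        using approx[OF f \<delta>] by blast
      obtain k where k: "k \<in> W \<inter> D" "\<bar>blinfun_apply k x - blinfun_apply g x\<bar> < \<epsilon> / 2"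
        using approx[OF g \<delta>] by blast
      have "\<bar>blinfun_apply h x - blinfun_apply k x\<bar> \<le> norm (h - k) * norm x"
        using norm_blinfun[of "h - k" x] by (simp add: blinfun.diff_left)
      also have "\<dots> \<le> d * norm x"
        using d(2)[OF h(1) k(1)] by (intro mult_right_mono) (simp_all add: dist_norm)
      finally show "norm (blinfun_apply (f - g) x) \<le> d * norm x + \<epsilon>"
        using h(2) k(2) unfolding blinfun.diff_left real_norm_def by linarith
    qed
  qed
  then show ?thesis
    by (simp add: dist_norm)
qed

theorem proposition2p10:
  fixes Y :: "'a::banach set"
  assumes "(UNIV :: 'a set) \<noteq> {0}"
    and "Y \<noteq> {0}"
    and "strict_ideal Y"
    and "dual_has_weak_star_BHP_on Y"
  shows "dual_has_weak_star_BHP TYPE('a)"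
  unfolding dual_has_weak_star_BHP_def small_relatively_open_sets_def
proof (intro allI impI)
  fix \<epsilon> :: real
  assume "\<epsilon> > 0"
  let ?res = "\<lambda>h :: 'a \<Rightarrow>\<^sub>L real. restrict (blinfun_apply h) Y"
  let ?\<Pi> = "product_topology (\<lambda>_. euclideanreal) Y"
  obtain P :: "('a \<Rightarrow>\<^sub>L real) \<Rightarrow>\<^sub>L ('a \<Rightarrow>\<^sub>L real)" where Y: "subspace Y"
    and P: "P o\<^sub>L P = P" "norm P = 1" "{f. blinfun_apply P f = 0} = annihilator Y"
    and dense: "cball 0 1 \<subseteq> weak_star_topology closure_of (range (blinfun_apply P) \<inter> cball 0 1)"
    using assms(3) unfolding strict_ideal_def by blast
  obtain U where U: "openin (subtopology (weak_star_topology_on Y) (dual_ball_on Y)) U" "U \<noteq> {}"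
    and diam: "(SUP (f, g) \<in> U \<times> U. dual_dist_on Y f g) < \<epsilon>"
    using assms(4) \<open>\<epsilon> > 0\<close> unfolding dual_has_weak_star_BHP_on_def small_relatively_open_sets_def
    by blast
  have "dual_on Y \<inter> dual_ball_on Y = dual_ball_on Y"
    by (auto simp: dual_ball_on_def)
  then obtain O' where O': "openin ?\<Pi> O'" and U_eq: "U = O' \<inter> dual_ball_on Y"
    using U(1) unfolding weak_star_topology_on_def subtopology_subtopology
    by (auto simp: openin_subtopology)
  \<comment> \<open>\<open>W\<close> is open in the whole dual and not only in its ball, so that it can be intersected with
    the weak-star dense set.\<close>
  define W where "W = {h \<in> topspace weak_star_topology. ?res h \<in> O'}"
  have W: "openin weak_star_topology W"
    unfolding W_def by (rule openin_continuous_map_preimage[OF continuous_map_restrict_weak_star O'])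
  have W_iff: "h \<in> W \<longleftrightarrow> ?res h \<in> O'" for h
    by (simp add: W_def strong_operator_topology_topspace)
  have res_U: "?res h \<in> U" if "h \<in> W \<inter> cball 0 1" for h
    using that restrict_in_dual_ball_on[OF Y, of h] by (simp add: W_iff U_eq)
  define d where "d = (SUP (f, g) \<in> U \<times> U. dual_dist_on Y f g)"
  have d_upper: "dual_dist_on Y f g \<le> d" if "f \<in> U" "g \<in> U" for f g
  proof -
    have "bdd_above ((\<lambda>(f, g). dual_dist_on Y f g) ` (U \<times> U))"
      by (rule bdd_aboveI[where M = 2]) (auto simp: U_eq intro: dual_dist_on_ball_le[OF Y])
    then show ?thesis
      unfolding d_def using that cSUP_upper[of "(f, g)" "U \<times> U"] by fastforce
  qed
  obtain f where f: "f \<in> U" using U(2) by blast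
  then have "f \<in> dual_on Y" "dual_norm_on Y f \<le> 1"
    by (auto simp: U_eq dual_ball_on_def)
  then obtain k where k: "?res k = f" "norm k \<le> 1"
    using dual_on_extension[OF Y] by (metis order_trans)
  then have k_in: "k \<in> W \<inter> cball 0 1"
    using f by (simp add: W_iff U_eq)
  have "0 \<le> dual_norm_on Y (?res (k - k))"
    by (rule dual_norm_on_nonneg[OF Y restrict_blinfun_in_dual_on[OF Y]])
  also have "\<dots> = dual_norm_on Y (blinfun_apply (k - k))"
    by (rule dual_norm_on_cong) simp
  also have "\<dots> = dual_dist_on Y f f"
    using dual_dist_on_restrict[of Y k k] by (simp only: k(1))
  also have "\<dots> \<le> d"
    by (rule d_upper[OF f f])
  finally have "d \<ge> 0" .
  have fixed: "blinfun_apply P h = h" if "h \<in> range (blinfun_apply P)" for h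
    using that arg_cong[OF P(1), of blinfun_apply] by (auto simp: fun_eq_iff)
  have close: "dist g h \<le> d"
    if g: "g \<in> W \<inter> (range (blinfun_apply P) \<inter> cball 0 1)"
      and h: "h \<in> W \<inter> (range (blinfun_apply P) \<inter> cball 0 1)" for g h
  proof -
    have "blinfun_apply P (g - h) = g - h"
      using fixed[of g] fixed[of h] g h by (simp add: blinfun.diff_right)
    then have "norm (g - h) \<le> dual_norm_on Y (blinfun_apply (g - h))"
      using P by (intro norm_le_dual_norm_on_of_range[OF Y]) auto
    also have "\<dots> = dual_dist_on Y (?res g) (?res h)"
      by (rule dual_dist_on_restrict[symmetric])
    also have "\<dots> \<le> d"
      using g h by (intro d_upper res_U) auto
    finally show ?thesis by (simp add: dist_norm)
  qed
  have "(SUP (g, h) \<in> (W \<inter> cball 0 1) \<times> (W \<inter> cball 0 1). dist g h) \<le> d"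
  proof (rule cSUP_least)
    show "(W \<inter> cball 0 1) \<times> (W \<inter> cball 0 1) \<noteq> {}"
      using k_in by blast
    fix gh
    assume "gh \<in> (W \<inter> cball 0 1) \<times> (W \<inter> cball 0 1)"
    then obtain g h where gh: "gh = (g, h)" "g \<in> W \<inter> cball 0 1" "h \<in> W \<inter> cball 0 1"
      by blast
    then have "dist g h \<le> d"
      using dense by (intro dist_le_of_dense[OF W _ _ _ _ \<open>d \<ge> 0\<close> close]) auto
    then show "(case gh of (g, h) \<Rightarrow> dist g h) \<le> d"
      by (simp add: gh(1))
  qed
  also have "d < \<epsilon>"
    using diam by (simp add: d_def)
  finally have "(SUP (g, h) \<in> (W \<inter> cball 0 1) \<times> (W \<inter> cball 0 1). dist g h) < \<epsilon>" .
  moreover have "openin (subtopology weak_star_topology (cball 0 1)) (W \<inter> cball 0 1)"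
    using W by (auto simp: openin_subtopology)
  ultimately show "\<exists>U :: ('a \<Rightarrow>\<^sub>L real) set.
      openin (subtopology weak_star_topology (cball 0 1)) U \<and> U \<noteq> {} \<and>
      (SUP (f, g) \<in> U \<times> U. dist f g) < \<epsilon>"
    using k_in by (intro exI[of _ "W \<inter> cball 0 1"]) auto
qed

end
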